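(* Let $\mathbb{F}_q$ be the finite field with $q$ elements, let $n>0$ be an integer, let $\mathcal{F}$ be a vector space over $\mathbb{F}_q$, and let $\phi\colon\mathcal{F}\to\mathrm{Map}(\mathbb{A}^n(\mathbb{F}_q),\mathbb{F}_q)$ be a homomorphism of vector spaces over $\mathbb{F}_q$. Then any subset of $\mathbb{A}^n(\mathbb{F}_q)$ defined by some members of $\mathcal{F}$ can be defined using at most $n$ members of $\mathcal{F}$. That is, for every subset $\mathcal{G}\subseteq\mathcal{F}$ there exist an integer $0\le m\le n$ and $h_1,\ldots,h_m\in\mathcal{F}$ such that $$\{x\in\mathbb{A}^n(\mathbb{F}_q) : \phi(f)(x)=0 \text{ for all } f\in\mathcal{G}\}=\{x\in\mathbb{A}^n(\mathbb{F}_q) : \phi(h_1)(x)=\cdots=\phi(h_m)(x)=0\}.$$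
   Context: $\mathbb{A}^n(\mathbb{F}_q)=\mathbb{F}_q^n$ denotes (the set of points of) the affine $n$-space over $\mathbb{F}_q$. For a set $X$, $\mathrm{Map}(X,\mathbb{F}_q)$ denotes the $\mathbb{F}_q$-vector space of all functions $X\to\mathbb{F}_q$ (with pointwise operations). The subset defined by some members of $\mathcal{F}$ is the common zero locus of their images via $\phi$. *)

theory Defs
  imports "HOL-Analysis.Finite_Cartesian_Product" "HOL-Library.Function_Algebras"
begin

text \<open>Addition of functions is pointwise, by the instances in
  \<^theory>\<open>HOL-Library.Function_Algebras\<close>; this is the matching pointwise scalar multiplication.\<close>

definition map_scale :: "'k::field \<Rightarrow> ('x \<Rightarrow> 'k) \<Rightarrow> ('x \<Rightarrow> 'k)" where
  "map_scale c f = (\<lambda>x. c * f x)"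

lemma vector_space_map_scale: "vector_space (map_scale :: 'k::field \<Rightarrow> ('x \<Rightarrow> 'k) \<Rightarrow> _)"
  by unfold_locales (simp_all add: map_scale_def fun_eq_iff algebra_simps)

definition zero_locus :: "('v \<Rightarrow> 'x \<Rightarrow> 'k::zero) \<Rightarrow> 'v set \<Rightarrow> 'x set" where
  "zero_locus \<phi> G = {x. \<forall>f\<in>G. \<phi> f x = 0}"

end

theory Submission
  imports Defs
begin

text \<open>Averaged over all members \<open>f\<close> of the span of \<open>G\<close>, the proportion of the points outside the
  zero locus of \<open>G\<close> at which \<open>f\<close> vanishes is exactly \<open>1/q\<close>. Since \<open>f = 0\<close> lies above
  the average, some \<open>f\<close> leaves strictly less than \<open>1/q\<close> of these points. There are at most
  \<open>q\<^sup>n\<close> of them, so after \<open>n\<close> greedy choices fewer than one is left.\<close>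

interpretation map_space: vector_space "map_scale :: 'k::field \<Rightarrow> ('x \<Rightarrow> 'k) \<Rightarrow> _"
  by (rule vector_space_map_scale)

text \<open>Evaluation at \<open>x\<close> is a linear functional on \<open>V\<close>, nonzero
  because of \<open>v\<close>, so \<open>V\<close> is the direct sum of its kernel and the line
  through \<open>v\<close>.\<close>

lemma card_vanishing_at:
  fixes V :: "('x \<Rightarrow> 'k::{field,finite}) set"
  assumes sub: "map_space.subspace V" and v: "v \<in> V" "v x \<noteq> 0"
  shows "CARD('k) * card {f \<in> V. f x = 0} = card V"
proof -
  define K where "K = {f \<in> V. f x = 0}"
  have "bij_betw (\<lambda>(c, f). f + map_scale c v) (UNIV \<times> K) V"
  \<comment> \<open>The scalar \<open>g x / v x\<close> is the one whose multiple of
    \<open>v\<close> must be subtracted from \<open>g\<close> to get a function vanishing at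
    \<open>x\<close>.\<close>
  proof (rule bij_betw_byWitness[where f' = "\<lambda>g. (g x / v x, g - map_scale (g x / v x) v)"])
    show "(\<lambda>(c, f). f + map_scale c v) ` (UNIV \<times> K) \<subseteq> V"
      using sub v by (auto simp: K_def intro!: map_space.subspace_add map_space.subspace_scale)
    have "g - map_scale (g x / v x) v \<in> K" if "g \<in> V" for g
    proof -
      have "g - map_scale (g x / v x) v \<in> V"
        using sub v that by (intro map_space.subspace_diff map_space.subspace_scale)
      moreover have "(g - map_scale (g x / v x) v) x = 0"
        using v by (simp add: map_scale_def)
      ultimately show ?thesis
        by (simp add: K_def)
    qed
    then show "(\<lambda>g. (g x / v x, g - map_scale (g x / v x) v)) ` V \<subseteq> UNIV \<times> K"
      by auto
  qed (use v in \<open>auto simp: K_def map_scale_def fun_eq_iff\<close>)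
  from bij_betw_same_card[OF this] show ?thesis
    by (simp add: card_cartesian_product K_def)
qed

lemma exists_few_zeros:
  fixes V :: "('x \<Rightarrow> 'k::{field,finite}) set"
  assumes sub: "map_space.subspace V" and fin: "finite V" "finite S" and "S \<noteq> {}"
    and nz: "\<And>x. x \<in> S \<Longrightarrow> \<exists>v\<in>V. v x \<noteq> 0"
  shows "\<exists>f\<in>V. CARD('k) * card {x \<in> S. f x = 0} < card S"
proof (rule ccontr)
  assume "\<not> ?thesis"
  then have ge: "card S \<le> CARD('k) * card {x \<in> S. f x = 0}" if "f \<in> V" for f
    using that by (meson not_le)
  have zero: "0 \<in> V"
    using sub by (rule map_space.subspace_0)
  have "card V * card S = (\<Sum>f\<in>V. card S)"
    by simp
  also have "\<dots> < (\<Sum>f\<in>V. CARD('k) * card {x \<in> S. f x = 0})"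
  proof (rule sum_strict_mono_ex1)
    have "2 \<le> CARD('k)"
      using card_mono[of UNIV "{0, 1 :: 'k}"] by simp
    moreover have "0 < card S"
      using fin \<open>S \<noteq> {}\<close> by (simp add: card_gt_0_iff)
    ultimately have "card S < CARD('k) * card S"
      by simp
    then show "\<exists>f\<in>V. card S < CARD('k) * card {x \<in> S. f x = 0}"
      using zero by (intro bexI[of _ 0]) simp_all
  qed (use fin ge in auto)
  \<comment> \<open>Double counting of the pairs of \<open>f\<close> in \<open>V\<close> and
    \<open>x\<close> in \<open>S\<close> with \<open>f x = 0\<close>: summed over points instead,
    each term is known exactly.\<close>
  also have "\<dots> = CARD('k) * (\<Sum>x\<in>S. card {f \<in> V. f x = 0})"
    using sum_multicount_gen[of V S "\<lambda>f x. f x = 0" "\<lambda>x. card {f \<in> V. f x = 0}"] fin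
    by (simp flip: sum_distrib_left)
  also have "\<dots> = (\<Sum>x\<in>S. card V)"
    unfolding sum_distrib_left
    by (rule sum.cong) (use nz card_vanishing_at[OF sub] in blast)+
  finally show False
    by (simp add: mult.commute)
qed

text \<open>The exponent starts at \<open>Suc 0\<close> because at least one choice is needed:
  \<open>card S \<le> 1\<close> alone does not make \<open>S\<close> empty, and only the strict
  inequality of a choice excludes the last point.\<close>

lemma exists_separating_sequence:
  fixes V :: "('x \<Rightarrow> 'k::{field,finite}) set"
  assumes sub: "map_space.subspace V" and "finite V" "finite S"
    and "\<And>x. x \<in> S \<Longrightarrow> \<exists>v\<in>V. v x \<noteq> 0"
    and "card S \<le> CARD('k) ^ Suc k"
  shows "\<exists>h. range h \<subseteq> V \<and> (\<forall>x\<in>S. \<exists>i\<in>{1..Suc k}. h i x \<noteq> 0)"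
proof -
  have zero: "(\<lambda>_. 0) \<in> V"
    using map_space.subspace_0[OF sub] by (simp add: zero_fun_def)
  show ?thesis
    using assms(3-5)
  proof (induction k arbitrary: S)
    case (0 S)
    show ?case
    proof (cases "S = {}")
      case True
      then show ?thesis
        using zero by (intro exI[of _ "\<lambda>_ _. 0"]) auto
    next
      case False
      then obtain f where f: "f \<in> V" "CARD('k) * card {x \<in> S. f x = 0} < card S"
        using exists_few_zeros[OF sub \<open>finite V\<close>] 0 by meson
      have "CARD('k) * card {x \<in> S. f x = 0} < CARD('k) * CARD('k) ^ 0"
        using f(2) 0(3) unfolding power_Suc by (rule order_less_le_trans)
      then have "{x \<in> S. f x = 0} = {}"
        unfolding mult_less_cancel1 using \<open>finite S\<close> by auto
      then show ?thesis
        using f by (intro exI[of _ "\<lambda>_. f"]) auto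
    qed
  next
    case (Suc k S)
    show ?case
    proof (cases "S = {}")
      case True
      then show ?thesis
        using zero by (intro exI[of _ "\<lambda>_ _. 0"]) auto
    next
      case False
      then obtain f where f: "f \<in> V" "CARD('k) * card {x \<in> S. f x = 0} < card S"
        using exists_few_zeros[OF sub \<open>finite V\<close>] Suc.prems by meson
      have "CARD('k) * card {x \<in> S. f x = 0} < CARD('k) * CARD('k) ^ Suc k"
        using f(2) Suc.prems(3) unfolding power_Suc by (rule order_less_le_trans)
      \<comment> \<open>Strictness may be dropped here, since the base case regains it with its own
        choice.\<close>
      then have "card {x \<in> S. f x = 0} \<le> CARD('k) ^ Suc k"
        unfolding mult_less_cancel1 by simp
      then obtain h where h: "range h \<subseteq> V"
          "\<forall>x\<in>{x \<in> S. f x = 0}. \<exists>i\<in>{1..Suc k}. h i x \<noteq> 0"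
        using Suc.IH[of "{x \<in> S. f x = 0}"] Suc.prems by auto
      show ?thesis
      proof (intro exI[of _ "h(Suc (Suc k) := f)"] conjI ballI)
        fix x assume "x \<in> S"
        show "\<exists>i\<in>{1..Suc (Suc k)}. (h(Suc (Suc k) := f)) i x \<noteq> 0"
        proof (cases "f x = 0")
          case True
          then obtain i where "i \<in> {1..Suc k}" "h i x \<noteq> 0"
            using h \<open>x \<in> S\<close> by blast
          then show ?thesis
            by (intro bexI[of _ i]) auto
        qed (auto intro!: bexI[of _ "Suc (Suc k)"])
      qed (use h f in auto)
    qed
  qed
qed

theorem corollary3:
  fixes scale :: "'k::{field,finite} \<Rightarrow> 'v::ab_group_add \<Rightarrow> 'v"
    and \<phi> :: "'v \<Rightarrow> ('k ^ 'n \<Rightarrow> 'k)"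
    and G :: "'v set"
  assumes "vector_space scale"
    and "Vector_Spaces.linear scale map_scale \<phi>"
  shows "\<exists>m \<le> CARD('n). \<exists>h :: nat \<Rightarrow> 'v.
    zero_locus \<phi> G = {x. \<forall>i\<in>{1..m}. \<phi> (h i) x = 0}"
proof -
  interpret lin: Vector_Spaces.linear scale map_scale \<phi>
    by (rule assms(2))
  \<comment> \<open>Averaging needs a subspace, hence the span; by \<open>vanish\<close> below,
    passing to it keeps every common zero of \<open>G\<close>.\<close>
  define V where "V = \<phi> ` lin.vs1.span G"
  define S where "S = - zero_locus \<phi> G"
  have sub: "map_space.subspace V"
    unfolding V_def by (intro lin.subspace_image lin.vs1.subspace_span)
  have nz: "\<exists>v\<in>V. v x \<noteq> 0" if "x \<in> S" for x
    using that lin.vs1.span_base by (fastforce simp: S_def V_def zero_locus_def)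
  have vanish: "v x = 0" if x: "x \<in> zero_locus \<phi> G" and v: "v \<in> V" for v x
  proof -
    obtain f where f: "f \<in> lin.vs1.span G" "v = \<phi> f"
      using v by (auto simp: V_def)
    from f(1) have "\<phi> f x = 0"
      by (induction rule: lin.vs1.span_induct_alt)
        (use x in \<open>auto simp: lin.zero lin.add lin.scale map_scale_def zero_locus_def\<close>)
    with f show ?thesis by simp
  qed
  \<comment> \<open>An index type is nonempty, which encodes \<open>n > 0\<close>.\<close>
  obtain k where k: "CARD('n) = Suc k"
    using gr0_conv_Suc[of "CARD('n)"] by auto
  have "card S \<le> CARD('k ^ 'n)"
    by (intro card_mono) auto
  then have "card S \<le> CARD('k) ^ Suc k"
    by (simp add: k)
  then obtain g where g: "range g \<subseteq> V" "\<forall>x\<in>S. \<exists>i\<in>{1..Suc k}. g i x \<noteq> 0"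
    using exists_separating_sequence[OF sub _ _ nz, of S k] by auto
  then have "\<forall>i. \<exists>f. g i = \<phi> f"
    by (auto simp: V_def)
  then obtain h where h: "\<And>i. g i = \<phi> (h i)"
    by metis
  \<comment> \<open>Members of \<open>V\<close> vanish on the locus, and the sequence excludes every
    point of its complement \<open>S\<close>; exactly \<open>n\<close> functions are used,
    repetitions allowed.\<close>
  have "zero_locus \<phi> G = {x. \<forall>i\<in>{1..Suc k}. \<phi> (h i) x = 0}"
    using g vanish by (fastforce simp: S_def h[symmetric])
  then show ?thesis
    unfolding k by blast
qed

end
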